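(* Let $k$ be a field of characteristic zero, let $R$ be a UFD which is a finitely generated $k$-algebra, and let $B=R[X_1,X_2]$ be the polynomial ring in two variables over $R$. Let $D$ be an irreducible locally nilpotent $R$-derivation on $B$ which is not fixed point free, and let $A=\mathrm{Ker}(D)$. Suppose that the following conditions hold: (i) $b:=DX_1\in R$ is irreducible; (ii) $DX_2=-f'(X_1)$, where $f(X_1)=\sum_{i=0}^{m}f_iX_1^i\in R[X_1]$ with $f_m\neq 0$; (iii) $D$ is strictly $1$-quasi-nice. Let $d=\max\{i\in\mathbb{N}: i\leqslant m \text{ and } b\nmid f_i\}$. If $(b,f_d)A=A$, then for each $j\geqslant 1$ the $j$-th image ideal $I_j=A\cap D^jB$ of $D$ satisfies $I_j=b^{m_j}A$, where $m_j=\min\{i_1+(d-1)i_2: i_1,i_2\in\mathbb{N},\ i_1+di_2=j\}$.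
   Context: All rings are commutative with unity; $\mathbb{N}$ is the set of non-negative integers. A locally nilpotent $R$-derivation on an $R$-algebra $B$ is an $R$-linear map $D:B\to B$ satisfying the Leibniz rule such that for each $b\in B$ there is $n\in\mathbb{N}$ with $D^n b=0$; $\mathrm{Ker}(D)=\{b\in B: Db=0\}$. For $j\geqslant 1$, the $j$-th image ideal of $D$ is the ideal $I_j=\mathrm{Ker}(D)\cap D^jB$ of $\mathrm{Ker}(D)$. $D$ is irreducible if there is no non-unit $b\in B$ with $DB\subseteq bB$. $D$ is fixed point free if $(DB)B=B$, i.e. the ideal of $B$ generated by $DB$ is $B$. For $B$ a polynomial ring in $n$ variables over $R$ and $1\leqslant m\leqslant n$, a locally nilpotent $R$-derivation $D$ of $B$ is $m$-quasi-nice if there is a coordinate system $Y_1,\dots,Y_n$ of $B$ (i.e. $B=R[Y_1,\dots,Y_n]$) such that $D^2(Y_i)=0$ for all $i\in\{1,\dots,m\}$; it is strictly $m$-quasi-nice if it is $m$-quasi-nice but not $r$-quasi-nice for any positive integer $r>m$. Here $f'$ is the derivative of $f$ with respect to $X_1$. *)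

theory Defs
  imports "HOL-Computational_Algebra.Computational_Algebra"
begin

text \<open>
  An algebra is a type \<open>'b\<close> of class \<open>comm_ring_1\<close> together with its structure map
  \<open>\<iota> :: 'r \<Rightarrow> 'b\<close>, a unital ring homomorphism.
\<close>

definition ring_morphism :: "('r::comm_ring_1 \<Rightarrow> 'b::comm_ring_1) \<Rightarrow> bool" where
  "ring_morphism \<iota> \<longleftrightarrow>
     \<iota> 1 = 1 \<and> (\<forall>x y. \<iota> (x + y) = \<iota> x + \<iota> y) \<and> (\<forall>x y. \<iota> (x * y) = \<iota> x * \<iota> y)"

text \<open>
  The subalgebra \<open>R[S]\<close>. Closure under negation follows, since \<open>\<iota> (-1)\<close> belongs to it.
\<close>

inductive_set subalgebra_gen :: "('r::comm_ring_1 \<Rightarrow> 'b::comm_ring_1) \<Rightarrow> 'b set \<Rightarrow> 'b set"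
  for \<iota> S where
  scalar: "\<iota> c \<in> subalgebra_gen \<iota> S"
| generator: "s \<in> S \<Longrightarrow> s \<in> subalgebra_gen \<iota> S"
| sum: "x \<in> subalgebra_gen \<iota> S \<Longrightarrow> y \<in> subalgebra_gen \<iota> S \<Longrightarrow> x + y \<in> subalgebra_gen \<iota> S"
| product: "x \<in> subalgebra_gen \<iota> S \<Longrightarrow> y \<in> subalgebra_gen \<iota> S \<Longrightarrow> x * y \<in> subalgebra_gen \<iota> S"

definition finitely_generated_algebra :: "('r::comm_ring_1 \<Rightarrow> 'b::comm_ring_1) \<Rightarrow> bool" where
  "finitely_generated_algebra \<iota> \<longleftrightarrow>
     ring_morphism \<iota> \<and> (\<exists>S. finite S \<and> subalgebra_gen \<iota> S = UNIV)"

text \<open>The ideal \<open>(S)A\<close> of the subring \<open>A\<close> generated by \<open>S \<subseteq> A\<close>.\<close>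

definition ideal_gen :: "'b::comm_ring_1 set \<Rightarrow> 'b set \<Rightarrow> 'b set" where
  "ideal_gen A S = {\<Sum>s\<in>T. c s * s | T c. finite T \<and> T \<subseteq> S \<and> c ` T \<subseteq> A}"

definition locally_nilpotent_derivation ::
    "('r::comm_ring_1 \<Rightarrow> 'b::comm_ring_1) \<Rightarrow> ('b \<Rightarrow> 'b) \<Rightarrow> bool" where
  "locally_nilpotent_derivation \<iota> D \<longleftrightarrow>
     (\<forall>x y. D (x + y) = D x + D y) \<and>
     (\<forall>c x. D (\<iota> c * x) = \<iota> c * D x) \<and>
     (\<forall>x y. D (x * y) = D x * y + x * D y) \<and>
     (\<forall>x. \<exists>n. (D ^^ n) x = 0)"

definition Ker :: "('b::comm_ring_1 \<Rightarrow> 'b) \<Rightarrow> 'b set" where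
  "Ker D = {x. D x = 0}"

definition image_ideal :: "('b::comm_ring_1 \<Rightarrow> 'b) \<Rightarrow> nat \<Rightarrow> 'b set" where
  "image_ideal D j = Ker D \<inter> range (D ^^ j)"

definition irreducible_derivation :: "('b::comm_ring_1 \<Rightarrow> 'b) \<Rightarrow> bool" where
  "irreducible_derivation D \<longleftrightarrow> \<not> (\<exists>a. \<not> a dvd 1 \<and> range D \<subseteq> range ((*) a))"

definition fixed_point_free :: "('b::comm_ring_1 \<Rightarrow> 'b) \<Rightarrow> bool" where
  "fixed_point_free D \<longleftrightarrow> ideal_gen UNIV (range D) = UNIV"

text \<open>
  The next three notions are meant for \<open>'b\<close> a polynomial ring in \<open>n\<close> variables over \<open>'r\<close>.
  There, \<open>n\<close> elements with \<open>B = R[Y\<^sub>1, \<dots>, Y\<^sub>n]\<close> are automatically algebraically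
  independent over \<open>R\<close>, because a surjective endomorphism of a finitely generated commutative
  algebra is injective.
\<close>

definition coordinate_system ::
    "('r::comm_ring_1 \<Rightarrow> 'b::comm_ring_1) \<Rightarrow> nat \<Rightarrow> (nat \<Rightarrow> 'b) \<Rightarrow> bool" where
  "coordinate_system \<iota> n Y \<longleftrightarrow> subalgebra_gen \<iota> (Y ` {1..n}) = UNIV"

definition quasi_nice ::
    "('r::comm_ring_1 \<Rightarrow> 'b::comm_ring_1) \<Rightarrow> nat \<Rightarrow> nat \<Rightarrow> ('b \<Rightarrow> 'b) \<Rightarrow> bool" where
  "quasi_nice \<iota> n m D \<longleftrightarrow>
     1 \<le> m \<and> m \<le> n \<and> (\<exists>Y. coordinate_system \<iota> n Y \<and> (\<forall>i\<in>{1..m}. (D ^^ 2) (Y i) = 0))"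

definition strictly_quasi_nice ::
    "('r::comm_ring_1 \<Rightarrow> 'b::comm_ring_1) \<Rightarrow> nat \<Rightarrow> nat \<Rightarrow> ('b \<Rightarrow> 'b) \<Rightarrow> bool" where
  "strictly_quasi_nice \<iota> n m D \<longleftrightarrow> quasi_nice \<iota> n m D \<and> (\<forall>r>m. \<not> quasi_nice \<iota> n r D)"

text \<open>
  \<open>R[X\<^sub>1, X\<^sub>2]\<close> is the type \<open>'r poly poly\<close>, read as \<open>R[X\<^sub>1][X\<^sub>2]\<close>:
  the inner variable is \<open>X\<^sub>1\<close>, the outer one is \<open>X\<^sub>2\<close>.
\<close>

definition scal :: "'r::comm_ring_1 \<Rightarrow> 'r poly poly" where
  "scal c = [:[:c:]:]"

definition X1 :: "'r::comm_ring_1 poly poly" where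
  "X1 = [:[:0, 1:]:]"

definition X2 :: "'r::comm_ring_1 poly poly" where
  "X2 = [:0, 1:]"

definition in_X1 :: "'r::comm_ring_1 poly \<Rightarrow> 'r poly poly" where
  "in_X1 f = [:f:]"

end

theory Submission
  imports Defs
begin

text \<open>
  Write \<open>x = X\<^sub>1\<close>, and let \<open>p\<close> be the part of \<open>f\<close> of degree less than \<open>d\<close>, so that
  \<open>f = p + f\<^sub>d x\<^sup>d + b g\<close>. The element \<open>F = b X\<^sub>2 + f(x)\<close> is killed by \<open>D\<close>. Hence
  \<open>W = X\<^sub>2 + g(x)\<close> satisfies \<open>b W = F - p(x) - f\<^sub>d x\<^sup>d\<close>. Comparing constant terms,
  comaximality of \<open>b\<close> and \<open>f\<^sub>d\<close> in \<open>A\<close> gives \<open>r b + s f\<^sub>d = 1\<close> with \<open>r, s\<close> in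
  \<open>R\<close>, and then \<open>z = r x\<^sup>d - s W\<close> satisfies
  \<open>x\<^sup>d = b z + s (F - p(x))\<close>,
  a monic equation of degree \<open>d\<close> for \<open>x\<close> over \<open>A[z]\<close>; moreover \<open>X\<^sub>2\<close> lies in \<open>A[x, z]\<close>,
  so that \<open>B = A[x, z]\<close>.

  The monic equation shows that \<open>B\<close> is spanned over \<open>A\<close> by the elements
  \<open>e n = x ^ (n mod d) * z ^ (n div d)\<close> (lemma \<open>span_e_UNIV\<close>). Since \<open>D x = b\<close>, and since
  applying \<open>D ^^ d\<close> to the equation and cancelling \<open>b\<close> gives \<open>(D ^^ d) z = d! b ^ (d - 1)\<close>
  (lemma \<open>leading_z\<close>), the element \<open>e n\<close> has \<open>D\<close>-degree exactly \<open>n\<close>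
  (\<open>n\<close> is the largest exponent with \<open>(D ^^ n) (e n) \<noteq> 0\<close>) and \<open>(D ^^ n) (e n)\<close>
  is a positive integer times \<open>b ^ (n - n div d)\<close> (lemma \<open>leading_e\<close>). There is thus exactly one
  spanning element in each \<open>D\<close>-degree, so if \<open>(D ^^ j) h\<close> lies in \<open>A\<close>, it is the \<open>j\<close>-th coefficient of
  \<open>h\<close> times \<open>(D ^^ j) (e j)\<close> (lemma \<open>image_of_expansion\<close>). As positive integers are units,
  the \<open>j\<close>-th image ideal is generated by \<open>b ^ (j - j div d)\<close>. This exponent is the minimum
  \<open>m\<^sub>j\<close>: on \<open>i\<^sub>1 + d i\<^sub>2 = j\<close> the value \<open>i\<^sub>1 + (d - 1) i\<^sub>2 = j - i\<^sub>2\<close> is smallest for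
  the largest \<open>i\<^sub>2\<close>.

  Irreducibility of \<open>D\<close> yields \<open>d > 0\<close>: otherwise \<open>b\<close> divides all coefficients of
  \<open>f\<close> but \<open>f\<^sub>0\<close>, hence \<open>f'\<close>, hence the whole image of \<open>D\<close>.
\<close>

section \<open>Exponents\<close>

lemma mod_plus_pred_times_div:
  fixes n d :: nat
  assumes "d > 0"
  shows "n mod d + (d - 1) * (n div d) = n - n div d"
proof -
  have "n mod d + d * (n div d) = n" by simp
  then show ?thesis using assms by (cases d) (simp_all del: mod_mult_div_eq mult_div_mod_eq)
qed

lemma Min_exponents:
  fixes d j :: nat
  assumes "d > 0"
  shows "Min {i1 + (d - 1) * i2 | i1 i2. i1 + d * i2 = j} = j - j div d"
proof (rule Min_eqI)
  have bound: "j - j div d \<le> i1 + (d - 1) * i2 \<and> i1 + (d - 1) * i2 \<le> j"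
    if "i1 + d * i2 = j" for i1 i2
  proof -
    have "i2 * d \<le> j" using that by (simp add: mult.commute)
    then have "i2 \<le> j div d" using assms by (simp add: less_eq_div_iff_mult_less_eq)
    moreover have "i1 + (d - 1) * i2 + i2 = j" using assms that by (cases d) auto
    ultimately show ?thesis by linarith
  qed
  then have "{i1 + (d - 1) * i2 | i1 i2. i1 + d * i2 = j} \<subseteq> {..j}" by auto
  then show "finite {i1 + (d - 1) * i2 | i1 i2. i1 + d * i2 = j}" using finite_subset by blast
  show "j - j div d \<le> y" if "y \<in> {i1 + (d - 1) * i2 | i1 i2. i1 + d * i2 = j}" for y
    using that bound by auto
  have "j mod d + d * (j div d) = j" by simp
  moreover have "j - j div d = j mod d + (d - 1) * (j div d)"
    using mod_plus_pred_times_div[OF assms] by simp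
  ultimately show "j - j div d \<in> {i1 + (d - 1) * i2 | i1 i2. i1 + d * i2 = j}" by blast
qed

section \<open>Derivations and leading terms\<close>

locale derivation =
  fixes D :: "'b::idom \<Rightarrow> 'b"
  assumes D_add: "D (x + y) = D x + D y"
    and D_mult: "D (x * y) = D x * y + x * D y"
begin

lemma D_zero [simp]: "D 0 = 0"
proof -
  have "D 0 + D 0 = D 0 + 0" using D_add[of 0 0] by (simp only: add_0_right)
  then show ?thesis by (simp only: add_left_cancel)
qed

lemma D_one [simp]: "D 1 = 0"
proof -
  have "D 1 + D 1 = D 1 + 0"
    using D_mult[of 1 1] by (simp only: mult_1_left mult_1_right add_0_right)
  then show ?thesis by (simp only: add_left_cancel)
qed

lemma D_of_nat [simp]: "D (of_nat n) = 0"
  by (induction n) (simp_all add: D_add)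

lemma funpow_D_zero [simp]: "(D ^^ n) 0 = 0"
  by (induction n) simp_all

lemma funpow_D_add: "(D ^^ n) (x + y) = (D ^^ n) x + (D ^^ n) y"
  by (induction n) (simp_all add: D_add)

lemma funpow_D_sum: "(D ^^ n) (\<Sum>i\<in>S. g i) = (\<Sum>i\<in>S. (D ^^ n) (g i))"
  by (induction S rule: infinite_finite_induct) (simp_all add: funpow_D_add)

lemma funpow_D_const_mult: "D a = 0 \<Longrightarrow> (D ^^ n) (a * x) = a * (D ^^ n) x"
  by (induction n) (simp_all add: D_mult)

lemma Ker_add: "D x = 0 \<Longrightarrow> D y = 0 \<Longrightarrow> D (x + y) = 0"
  by (simp add: D_add)

lemma Ker_mult: "D x = 0 \<Longrightarrow> D y = 0 \<Longrightarrow> D (x * y) = 0"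
  by (simp add: D_mult)

lemma Ker_power: "D x = 0 \<Longrightarrow> D (x ^ n) = 0"
  by (induction n) (simp_all add: D_mult)

text \<open>
  The \<open>D\<close>-degree of \<open>x\<close> is at most \<open>n\<close>, with top value \<open>c\<close>. Allowing \<open>c = 0\<close> makes
  the notion multiplicative without case distinctions.
\<close>

definition leading :: "nat \<Rightarrow> 'b \<Rightarrow> 'b \<Rightarrow> bool" where
  "leading n c x \<longleftrightarrow> (D ^^ n) x = c \<and> D c = 0"

lemma leading_vanish:
  assumes "leading n c x" "n < k"
  shows "(D ^^ k) x = 0"
proof -
  obtain i where k: "k = i + Suc n"
    using assms(2) less_iff_Suc_add by (metis add.commute add_Suc_right)
  show ?thesis
    unfolding k funpow_add using assms(1) by (simp add: leading_def)
qed

text \<open>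
  By the degree bounds, only the term with \<open>(D ^^ m) x * (D ^^ n) y\<close> survives in the iterated
  Leibniz formula. The induction on \<open>m + n\<close> splits off one \<open>D\<close> and adds the two resulting binomial
  coefficients by Pascal's rule.
\<close>

lemma leading_mult:
  assumes "leading m c x" "leading n e y"
  shows "leading (m + n) (of_nat ((m + n) choose m) * c * e) (x * y)"
  using assms
proof (induction "m + n" arbitrary: m n x y)
  case 0
  then show ?case by (auto simp: leading_def D_mult)
next
  case (Suc k)
  have step: "leading i c (D u)" if "leading (Suc i) c u" for i c u
    using that by (simp add: leading_def funpow_swap1)
  have ce: "D c = 0" "D e = 0" using Suc.prems by (auto simp: leading_def)
  have D_Suc: "(D ^^ (m + n)) (x * y) = (D ^^ k) (D x * y) + (D ^^ k) (x * D y)"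
    using Suc.hyps(2)[symmetric] by (simp add: funpow_swap1 D_mult funpow_D_add)
  have "(D ^^ (m + n)) (x * y) = of_nat ((m + n) choose m) * c * e"
  proof (cases m)
    case 0
    then obtain n' where n: "n = Suc n'" using Suc.hyps(2) by (cases n) auto
    have "(D ^^ k) (x * D y) = c * e"
      using Suc.hyps(1)[of 0 n' x "D y"] Suc.hyps(2) Suc.prems step[of n' e y] 0 n
      by (simp add: leading_def)
    then show ?thesis using D_Suc Suc.prems(1) 0 by (simp add: leading_def)
  next
    case m: (Suc m')
    show ?thesis
    proof (cases n)
      case 0
      have "(D ^^ k) (D x * y) = c * e"
        using Suc.hyps(1)[of m' 0 "D x" y] Suc.hyps(2) Suc.prems step[of m' c x] 0 m
        by (simp add: leading_def)
      then show ?thesis using D_Suc Suc.prems(2) 0 by (simp add: leading_def)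
    next
      case n: (Suc n')
      have "(D ^^ k) (D x * y) = of_nat (k choose m') * c * e"
        using Suc.hyps(1)[of m' n "D x" y] Suc.hyps(2) Suc.prems step[of m' c x] m n
        by (simp add: leading_def)
      moreover have "(D ^^ k) (x * D y) = of_nat (k choose m) * c * e"
        using Suc.hyps(1)[of m n' x "D y"] Suc.hyps(2) Suc.prems step[of n' e y] m n
        by (simp add: leading_def)
      ultimately show ?thesis
        unfolding D_Suc using Suc.hyps(2)[symmetric] m by (simp add: algebra_simps)
    qed
  qed
  then show ?case by (simp add: leading_def Ker_mult ce)
qed

lemma leading_power:
  assumes "leading n c x"
  shows "\<exists>l>0. leading (k * n) (of_nat l * c ^ k) (x ^ k)"
proof (induction k)
  case 0
  show ?case by (rule exI[of _ 1]) (simp add: leading_def)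
next
  case (Suc k)
  then obtain l where l: "l > 0" "leading (k * n) (of_nat l * c ^ k) (x ^ k)" by blast
  have "leading (Suc k * n) (of_nat (((Suc k * n) choose n) * l) * c ^ Suc k) (x ^ Suc k)"
    using leading_mult[OF assms l(2)] by (simp add: mult_ac)
  moreover have "((Suc k * n) choose n) * l > 0" using l(1) by simp
  ultimately show ?case by blast
qed

end

section \<open>Image ideals in a tower of two generators\<close>

text \<open>
  The ring is generated over \<open>Ker D\<close> by an element \<open>x\<close> with \<open>D x = \<beta>\<close> in \<open>Ker D\<close> and by an
  element \<open>z\<close> for which \<open>\<beta> * z\<close> is a monic polynomial of degree \<open>d\<close> in \<open>x\<close> over \<open>Ker D\<close>.
\<close>

locale two_generator_derivation = derivation D
  for D :: "'b::idom \<Rightarrow> 'b" +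
  fixes \<iota> :: "'r::comm_ring_1 \<Rightarrow> 'b" and x z \<beta> :: 'b and d :: nat and q :: "nat \<Rightarrow> 'b"
  assumes D_\<iota>: "D (\<iota> c) = 0"
    and D_x: "D x = \<beta>" and D_\<beta>: "D \<beta> = 0" and \<beta>_nz: "\<beta> \<noteq> 0"
    and d_pos: "d > 0"
    and D_q: "D (q i) = 0"
    and relation: "x ^ d = \<beta> * z + (\<Sum>i<d. q i * x ^ i)"
    and generated: "subalgebra_gen \<iota> ({x, z} \<union> Ker D) = UNIV"
    and of_nat_unit: "n > 0 \<Longrightarrow> of_nat n dvd (1::'b)"
begin

definition e :: "nat \<Rightarrow> 'b" where
  "e n = x ^ (n mod d) * z ^ (n div d)"

inductive_set span_e :: "'b set" where
  zero: "0 \<in> span_e"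
| step: "D a = 0 \<Longrightarrow> h \<in> span_e \<Longrightarrow> a * e n + h \<in> span_e"

lemma span_e_const_mult: "h \<in> span_e \<Longrightarrow> D a = 0 \<Longrightarrow> a * h \<in> span_e"
proof (induction rule: span_e.induct)
  case (step c h n)
  have "(a * c) * e n + a * h \<in> span_e" using step by (intro span_e.step Ker_mult)
  then show ?case by (simp add: algebra_simps)
qed (simp add: span_e.zero)

lemma span_e_add: "h \<in> span_e \<Longrightarrow> k \<in> span_e \<Longrightarrow> h + k \<in> span_e"
  by (induction rule: span_e.induct) (simp_all add: add.assoc span_e.step)

lemma span_e_sum: "(\<And>i. i \<in> S \<Longrightarrow> g i \<in> span_e) \<Longrightarrow> sum g S \<in> span_e"
  by (induction S rule: infinite_finite_induct) (simp_all add: span_e.zero span_e_add)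

lemma e_in_span: "e n \<in> span_e"
  using span_e.step[OF D_one span_e.zero, of n] by simp

lemma e_mult_z: "z * e n = e (n + d)"
  using d_pos by (simp add: e_def)

lemma e_mult_x: "x * e n \<in> span_e"
proof (cases "Suc (n mod d) = d")
  case False
  then have "Suc n mod d = Suc (n mod d)" "Suc n div d = n div d"
    by (auto simp: mod_Suc div_Suc)
  then have "x * e n = e (Suc n)" by (simp add: e_def)
  then show ?thesis using e_in_span by simp
next
  case True
  \<comment> \<open>The exponent of \<open>x\<close> overflows to \<open>d\<close>, so the relation is needed to return to the \<open>e i\<close>.\<close>
  define k where "k = n div d"
  have pure_x: "x ^ i * z ^ k = e (i + d * k)" if "i < d" for i
    using that by (simp add: e_def)
  have "x * e n = x ^ d * z ^ k"
    unfolding e_def k_def by (metis True mult.assoc power_Suc)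
  also have "\<dots> = \<beta> * (z ^ Suc k) + (\<Sum>i<d. q i * e (i + d * k))"
    unfolding relation by (simp add: algebra_simps sum_distrib_left sum_distrib_right pure_x[symmetric])
  also have "z ^ Suc k = e (d * Suc k)"
    using d_pos by (simp add: e_def)
  also have "\<beta> * e (d * Suc k) + (\<Sum>i<d. q i * e (i + d * k)) \<in> span_e"
    by (intro span_e_add span_e_sum span_e_const_mult e_in_span D_\<beta> D_q)
  finally show ?thesis .
qed

lemma span_e_mult:
  assumes "\<And>n. w * e n \<in> span_e" "h \<in> span_e"
  shows "w * h \<in> span_e"
  using assms(2)
proof (induction rule: span_e.induct)
  case (step a h n)
  have "a * (w * e n) + w * h \<in> span_e"
    using step assms(1) by (blast intro: span_e_add span_e_const_mult)
  then show ?case by (simp add: algebra_simps)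
qed (simp add: span_e.zero)

text \<open>
  The span contains \<open>e 0 = 1\<close> and is stable under multiplication by the scalars and generators of the
  whole ring, so by all its elements.
\<close>

lemma span_e_UNIV: "h \<in> span_e"
proof -
  have "h \<in> subalgebra_gen \<iota> ({x, z} \<union> Ker D)" using generated by simp
  then have "\<forall>k\<in>span_e. h * k \<in> span_e"
  proof (induction rule: subalgebra_gen.induct)
    case (scalar c)
    then show ?case using span_e_const_mult D_\<iota> by blast
  next
    case (generator s)
    then consider "s = x" | "s = z" | "D s = 0" by (auto simp: Ker_def)
    then show ?case
      by cases (auto intro: span_e_mult e_mult_x span_e_const_mult simp: e_mult_z e_in_span)
  qed (auto simp: algebra_simps intro: span_e_add)
  moreover have "e 0 = 1" by (simp add: e_def)
  ultimately show ?thesis using e_in_span[of 0] by force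
qed

lemma span_e_coefficients:
  assumes "h \<in> span_e"
  shows "\<exists>N a. (\<forall>n. D (a n) = 0) \<and> h = (\<Sum>n<N. a n * e n)"
  using assms
proof (induction rule: span_e.induct)
  case zero
  show ?case by (rule exI[of _ 0], rule exI[of _ "\<lambda>_. 0"]) simp
next
  case (step c h m)
  then obtain N a where a: "\<forall>n. D (a n) = 0" "h = (\<Sum>n<N. a n * e n)" by blast
  define M where "M = max N (Suc m)"
  define a' where "a' n = (if n < N then a n else 0) + (if n = m then c else 0)" for n
  have "(\<Sum>n<M. a' n * e n) = (\<Sum>n<M. if n < N then a n * e n else 0)
      + (\<Sum>n<M. if n = m then c * e n else 0)"
    unfolding sum.distrib[symmetric] by (rule sum.cong) (auto simp: a'_def algebra_simps)
  also have "(\<Sum>n<M. if n < N then a n * e n else 0) = h"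
    unfolding a(2) by (rule sum.mono_neutral_cong_right) (auto simp: M_def)
  also have "(\<Sum>n<M. if n = m then c * e n else 0) = c * e m"
    by (simp add: M_def)
  finally have "c * e m + h = (\<Sum>n<M. a' n * e n)" by simp
  moreover have "\<forall>n. D (a' n) = 0" using a step by (auto simp: a'_def Ker_add)
  ultimately show ?case by blast
qed

lemma leading_x: "leading 1 \<beta> x"
  by (simp add: leading_def D_x D_\<beta>)

text \<open>
  Applying \<open>D ^^ d\<close> to the relation kills the lower powers of \<open>x\<close> and leaves
  \<open>\<beta> * (D ^^ d) z = l * \<beta> ^ d\<close> with \<open>l\<close> a positive integer (in fact \<open>d!\<close>). Cancelling \<open>\<beta>\<close> is
  what saves one factor \<open>\<beta>\<close> for each \<open>d\<close> applications of \<open>D\<close>.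
\<close>

lemma leading_z: "\<exists>l>0. leading d (of_nat l * \<beta> ^ (d - 1)) z"
proof -
  obtain l where l: "l > 0" "leading d (of_nat l * \<beta> ^ d) (x ^ d)"
    using leading_power[OF leading_x, of d] by auto
  have low: "(D ^^ d) (q i * x ^ i) = 0" if "i < d" for i
  proof -
    obtain l' where "leading i (of_nat l' * \<beta> ^ i) (x ^ i)"
      using leading_power[OF leading_x, of i] by auto
    then show ?thesis using leading_vanish that by (simp add: funpow_D_const_mult D_q)
  qed
  have "of_nat l * \<beta> ^ d = (D ^^ d) (x ^ d)" using l(2) by (simp add: leading_def)
  also have "\<dots> = \<beta> * (D ^^ d) z"
    unfolding relation by (simp add: funpow_D_add funpow_D_sum low funpow_D_const_mult D_\<beta>)
  finally have "\<beta> * (D ^^ d) z = of_nat l * \<beta> ^ d" by simp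
  also have "\<dots> = \<beta> * (of_nat l * \<beta> ^ (d - 1))"
    using d_pos by (cases d) (simp_all add: mult_ac)
  finally have "\<beta> * (D ^^ d) z = \<beta> * (of_nat l * \<beta> ^ (d - 1))" .
  then have "(D ^^ d) z = of_nat l * \<beta> ^ (d - 1)"
    using \<beta>_nz by (metis mult_left_cancel)
  then show ?thesis using l(1) by (auto simp: leading_def Ker_mult Ker_power D_\<beta>)
qed

lemma leading_e: "\<exists>l>0. leading n (of_nat l * \<beta> ^ (n - n div d)) (e n)"
proof -
  obtain l1 where l1: "l1 > 0" "leading (n mod d) (of_nat l1 * \<beta> ^ (n mod d)) (x ^ (n mod d))"
    using leading_power[OF leading_x, of "n mod d"] by auto
  obtain l0 where l0: "l0 > 0" "leading d (of_nat l0 * \<beta> ^ (d - 1)) z" using leading_z by blast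
  obtain l2 where l2: "l2 > 0"
    "leading (n div d * d) (of_nat l2 * (of_nat l0 * \<beta> ^ (d - 1)) ^ (n div d)) (z ^ (n div d))"
    using leading_power[OF l0(2)] by blast
  let ?l = "(n choose (n mod d)) * l1 * l2 * l0 ^ (n div d)"
  have "leading n (of_nat ?l * \<beta> ^ (n mod d + (d - 1) * (n div d))) (e n)"
    unfolding power_add power_mult using leading_mult[OF l1(2) l2(2)]
    by (simp add: e_def power_mult_distrib mult_ac)
  moreover have "?l > 0" using l0 l1 l2 by simp
  ultimately show ?thesis unfolding mod_plus_pred_times_div[OF d_pos] by blast
qed

text \<open>
  The \<open>e n\<close> have pairwise different \<open>D\<close>-degrees, so the top coefficients of an expansion are
  detected by high powers of \<open>D\<close>. A bound on the degree of the sum therefore truncates it, and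
  \<open>D ^^ j\<close> sees only the coefficient of \<open>e j\<close>.
\<close>

lemma image_of_expansion:
  assumes "\<forall>n. D (a n) = 0" "(D ^^ Suc j) (\<Sum>n<N. a n * e n) = 0"
  shows "\<exists>c. D c = 0 \<and> (D ^^ j) (\<Sum>n<N. a n * e n) = \<beta> ^ (j - j div d) * c"
  using assms(2)
proof (induction N)
  case 0
  show ?case by (rule exI[of _ 0]) simp
next
  case (Suc N)
  obtain l where l: "l > 0" "leading N (of_nat l * \<beta> ^ (N - N div d)) (e N)"
    using leading_e by blast
  have low: "(D ^^ k) (\<Sum>n<M. a n * e n) = 0" if "M \<le> k" for k M
    unfolding funpow_D_sum
  proof (rule sum.neutral, intro ballI)
    fix n assume "n \<in> {..<M}"
    then have "n < k" using that by simp
    then show "(D ^^ k) (a n * e n) = 0"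
      using leading_e[of n] leading_vanish assms(1) by (auto simp: funpow_D_const_mult)
  qed
  have top: "(D ^^ N) (\<Sum>n<Suc N. a n * e n) = a N * (of_nat l * \<beta> ^ (N - N div d))"
    using l(2) assms(1) low[of N N]
    by (simp add: funpow_D_add funpow_D_const_mult leading_def)
  consider "N < j" | "N = j" | "j < N" by linarith
  then show ?case
  proof cases
    case 1
    then show ?thesis using low[of "Suc N" j] by (intro exI[of _ 0]) simp
  next
    case 2
    then show ?thesis
      using top assms(1) by (intro exI[of _ "a N * of_nat l"]) (simp add: Ker_mult mult_ac)
  next
    case 3
    \<comment> \<open>The coefficient in degree \<open>N\<close> must vanish because \<open>D ^^ N\<close> kills the sum but not \<open>e N\<close>.\<close>
    then obtain i where "N = i + Suc j"
      using less_iff_Suc_add by (metis add.commute add_Suc_right)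
    then have "(D ^^ N) (\<Sum>n<Suc N. a n * e n) = 0"
      using Suc.prems by (simp only: funpow_add comp_apply funpow_D_zero)
    moreover have "of_nat l \<noteq> (0::'b)" using of_nat_unit[OF l(1)] by auto
    ultimately have "a N = 0" using top \<beta>_nz by simp
    then show ?thesis using Suc by simp
  qed
qed

theorem image_ideal_eq: "image_ideal D j = (\<lambda>a. \<beta> ^ (j - j div d) * a) ` Ker D"
proof (intro equalityI subsetI)
  fix y assume "y \<in> image_ideal D j"
  then obtain h where h: "y = (D ^^ j) h" "(D ^^ Suc j) h = 0"
    by (auto simp: image_ideal_def Ker_def)
  obtain N a where a: "\<forall>n. D (a n) = 0" "h = (\<Sum>n<N. a n * e n)"
    using span_e_coefficients[OF span_e_UNIV] by blast
  show "y \<in> (\<lambda>a. \<beta> ^ (j - j div d) * a) ` Ker D"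
    using image_of_expansion[OF a(1), of j N] h a(2) by (auto simp: Ker_def)
next
  fix y assume "y \<in> (\<lambda>a. \<beta> ^ (j - j div d) * a) ` Ker D"
  then obtain a where a: "D a = 0" "y = \<beta> ^ (j - j div d) * a" by (auto simp: Ker_def)
  obtain l where l: "l > 0" "leading j (of_nat l * \<beta> ^ (j - j div d)) (e j)"
    using leading_e by blast
  obtain u where u: "(1::'b) = of_nat l * u" using of_nat_unit[OF l(1)] by (auto simp: dvd_def)
  \<comment> \<open>The inverse of a positive integer is a constant of \<open>D\<close>, so it can be moved through \<open>D ^^ j\<close>.\<close>
  have "D (of_nat l * u) = 0" using u by (metis D_one)
  moreover have "of_nat l \<noteq> (0::'b)" using u by auto
  ultimately have "D u = 0" by (simp add: D_mult)
  then have "(D ^^ j) (u * a * e j) = (of_nat l * u) * y"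
    using l(2) a by (simp add: funpow_D_const_mult Ker_mult leading_def mult_ac)
  then have "y = (D ^^ j) (u * a * e j)" using u by simp
  then show "y \<in> image_ideal D j"
    using Ker_mult[OF Ker_power[OF D_\<beta>] a(1), of "j - j div d"] a(2)
    by (simp add: image_ideal_def Ker_def)
qed

end

section \<open>The polynomial ring in two variables\<close>

lemma scal_simps:
  "scal (x + y) = scal x + scal y" "scal (x * y) = scal x * scal y" "scal 1 = 1" "scal 0 = 0"
  "scal (- x) = - scal x"
  by (simp_all add: scal_def one_pCons)

lemma in_X1_simps:
  "in_X1 (p + r) = in_X1 p + in_X1 r" "in_X1 (p - r) = in_X1 p - in_X1 r"
  "in_X1 (p * r) = in_X1 p * in_X1 r" "in_X1 0 = 0" "in_X1 [:c:] = scal c"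
  by (simp_all add: in_X1_def scal_def)

lemma in_X1_pCons: "in_X1 (pCons c p) = scal c + X1 * in_X1 p"
  by (simp add: in_X1_def scal_def X1_def)

lemma in_X1_monom: "in_X1 (monom c i) = scal c * X1 ^ i"
  by (induction i) (simp_all add: monom_0 monom_Suc in_X1_simps in_X1_pCons scal_simps mult_ac)

lemma in_X1_sum: "in_X1 (\<Sum>i\<in>S. g i) = (\<Sum>i\<in>S. in_X1 (g i))"
  by (induction S rule: infinite_finite_induct) (simp_all add: in_X1_simps)

lemma scal_of_nat: "scal (of_nat n) = of_nat n"
  by (induction n) (simp_all add: scal_simps)

lemma scal_dvd_1: "scal b dvd 1 \<longleftrightarrow> b dvd (1::'r::idom)"
  by (simp add: scal_def one_pCons const_poly_dvd_iff coeff_pCons split: nat.splits)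

lemma in_X1_in_subalgebra: "X1 \<in> S \<Longrightarrow> in_X1 p \<in> subalgebra_gen scal S"
  by (induction p)
    (auto simp: in_X1_pCons in_X1_simps scal_simps(4)[symmetric] intro: subalgebra_gen.intros)

lemma subalgebra_gen_X1_X2:
  fixes P :: "'r::comm_ring_1 poly poly"
  assumes "X1 \<in> S" "X2 \<in> subalgebra_gen scal S"
  shows "P \<in> subalgebra_gen scal S"
proof (induction P)
  case 0
  show ?case using subalgebra_gen.scalar[of scal 0] by (simp add: scal_simps)
next
  case (pCons p P)
  have "pCons p P = in_X1 p + X2 * P" by (simp add: in_X1_def X2_def)
  then show ?case
    using pCons in_X1_in_subalgebra[OF assms(1)] assms(2) by (auto intro: subalgebra_gen.intros)
qed

text \<open>The inverse is the image of the one in the base field, which has characteristic zero.\<close>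

lemma of_nat_dvd_one:
  fixes \<phi> :: "'k::field_char_0 \<Rightarrow> 'r::comm_ring_1"
  assumes "ring_morphism \<phi>" "n > 0"
  shows "of_nat n dvd (1::'r)"
proof -
  have hom: "\<phi> 1 = 1" "\<phi> (x + y) = \<phi> x + \<phi> y" "\<phi> (x * y) = \<phi> x * \<phi> y" for x y
    using assms(1) by (auto simp: ring_morphism_def)
  have "\<phi> 0 = 0" using hom(2)[of 0 0] by simp
  then have "\<phi> (of_nat n) = of_nat n" by (induction n) (simp_all add: hom)
  moreover have "\<phi> (of_nat n) * \<phi> (inverse (of_nat n)) = 1"
    using assms(2) by (simp add: hom(1) flip: hom(3))
  ultimately show ?thesis by (metis dvd_triv_left)
qed

text \<open>
  Taking the constant term is a ring homomorphism onto \<open>R\<close> that fixes scalars, so it carries a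
  representation of \<open>1\<close> with coefficients in \<open>A\<close> to one with coefficients in \<open>R\<close>.
\<close>

lemma comaximal_scalars:
  fixes A :: "'r::comm_ring_1 poly poly set"
  assumes "1 \<in> ideal_gen A {scal b, scal c}"
  shows "\<exists>r s. r * b + s * c = 1"
proof -
  define ct where "ct P = coeff (coeff P 0) 0" for P :: "'r poly poly"
  have ct: "ct (P * Q) = ct P * ct Q" "ct 1 = 1" "ct (scal u) = u" for P Q u
    by (simp_all add: ct_def scal_def coeff_mult_0)
  have ct_sum: "ct (\<Sum>t\<in>T. g t) = (\<Sum>t\<in>T. ct (g t))" for T and g :: "'r poly poly \<Rightarrow> 'r poly poly"
    by (simp add: ct_def coeff_sum)
  obtain T v where T: "T \<subseteq> {scal b, scal c}" "1 = (\<Sum>t\<in>T. v t * t)"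
    using assms by (auto simp: ideal_gen_def)
  have one: "(\<Sum>t\<in>T. ct (v t) * ct t) = 1"
    using arg_cong[OF T(2), of ct] by (simp add: ct_sum ct)
  have "T \<in> Pow {scal b, scal c}" using T(1) by simp
  then consider "T = {}" | "T = {scal b}" | "T = {scal c}" | "T = {scal b, scal c}" "scal b \<noteq> scal c"
    by (auto simp: Pow_insert)
  then show ?thesis
  proof cases
    case 1
    with one show ?thesis by simp
  next
    case 2
    with one show ?thesis by (intro exI[of _ "ct (v (scal b))"] exI[of _ 0]) (simp add: ct)
  next
    case 3
    with one show ?thesis by (intro exI[of _ 0] exI[of _ "ct (v (scal c))"]) (simp add: ct)
  next
    case 4
    with one show ?thesis
      by (intro exI[of _ "ct (v (scal b))"] exI[of _ "ct (v (scal c))"]) (simp add: ct)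
  qed
qed

lemma chain_rule_in_X1:
  fixes D :: "'r::idom poly poly \<Rightarrow> 'r poly poly"
  assumes "derivation D" "\<And>c. D (scal c) = 0"
  shows "D (in_X1 p) = in_X1 (pderiv p) * D X1"
proof (induction p)
  case 0
  then show ?case using assms derivation.D_zero by (simp add: in_X1_simps)
next
  case (pCons c p)
  then show ?case
    by (simp add: in_X1_pCons pderiv_pCons in_X1_simps scal_simps assms(2)
        derivation.D_add[OF assms(1)] derivation.D_mult[OF assms(1)] algebra_simps)
qed

lemma dvd_derivation:
  fixes D :: "'r::idom poly poly \<Rightarrow> 'r poly poly"
  assumes "derivation D" "\<And>c. D (scal c) = 0" "w dvd D X1" "w dvd D X2"
  shows "w dvd D P"
proof -
  interpret derivation D by fact
  have "P \<in> subalgebra_gen scal {X1, X2}"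
    by (rule subalgebra_gen_X1_X2) (auto intro: subalgebra_gen.generator)
  then show ?thesis
    by (induction rule: subalgebra_gen.induct) (use assms in \<open>auto simp: D_add D_mult\<close>)
qed

section \<open>Image ideals of the given derivation\<close>

theorem corollary5p3:
  fixes \<phi> :: "'k::field_char_0 \<Rightarrow> 'r::{factorial_semiring, idom}"
    and D :: "'r poly poly \<Rightarrow> 'r poly poly"
    and A :: "'r poly poly set"
    and b :: 'r
    and f :: "'r poly"
    and m d :: nat
  assumes "finitely_generated_algebra \<phi>"
    and "locally_nilpotent_derivation scal D"
    and "irreducible_derivation D"
    and "\<not> fixed_point_free D"
    and "A = Ker D"
    and "D X1 = scal b" and "irreducible b"
    and "f = (\<Sum>i\<le>m. monom (coeff f i) i)" and "coeff f m \<noteq> 0"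
    and "D X2 = - in_X1 (pderiv f)"
    and "strictly_quasi_nice scal 2 1 D"
    and "d = Max {i. i \<le> m \<and> \<not> b dvd coeff f i}"
    and "ideal_gen A {scal b, scal (coeff f d)} = A"
  shows "\<forall>j\<ge>1. image_ideal D j =
           (\<lambda>a. scal b ^ Min {i1 + (d - 1) * i2 | i1 i2. i1 + d * i2 = j} * a) ` A"
proof -
  interpret derivation D
    using assms(2) by unfold_locales (auto simp: locally_nilpotent_derivation_def)
  have der: "derivation D" by unfold_locales
  have D_scal: "D (scal c) = 0" for c
  proof -
    have "D (scal c * 1) = scal c * D 1"
      using assms(2) unfolding locally_nilpotent_derivation_def by blast
    then show ?thesis by simp
  qed
  have deg_f: "coeff f i = 0" if "i > m" for i
  proof -
    have "coeff f i = (\<Sum>k\<le>m. coeff (monom (coeff f k) k) i)"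
      by (subst (1) assms(8)) (simp add: coeff_sum)
    also have "\<dots> = 0" using that by (intro sum.neutral) auto
    finally show ?thesis .
  qed

  have above: "b dvd coeff f i" if "i > d" for i
  proof (rule ccontr)
    assume "\<not> b dvd coeff f i"
    moreover from this have "i \<le> m" using deg_f by (metis dvd_0_right not_le_imp_less)
    ultimately have "i \<le> d" unfolding assms(12) by (intro Max_ge) auto
    then show False using that by simp
  qed

  have d_pos: "d > 0"
  proof (rule ccontr)
    assume "\<not> d > 0"
    then have "b dvd coeff f i" if "i > 0" for i using above that by simp
    then have "[:b:] dvd pderiv f" by (simp add: const_poly_dvd_iff coeff_pderiv)
    then have "scal b dvd D X2"
      unfolding assms(10) by (metis dvd_def in_X1_simps(3,5) dvd_minus_iff)
    then have "scal b dvd D P" for P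
      using dvd_derivation[OF der D_scal] assms(6) by simp
    then have "range D \<subseteq> range ((*) (scal b))" by (auto simp: dvd_def)
    then have "scal b dvd 1" using assms(3) by (auto simp: irreducible_derivation_def)
    then show False using assms(7) by (simp add: scal_dvd_1 irreducible_def)
  qed

  define p where "p = (\<Sum>i<d. monom (coeff f i) i)"
  have coeff_p: "coeff p i = (if i < d then coeff f i else 0)" for i
    unfolding p_def by (simp add: coeff_sum coeff_monom)
  have "[:b:] dvd f - p - monom (coeff f d) d"
    using above by (auto simp: const_poly_dvd_iff coeff_p coeff_monom)
  then obtain g where "f - p - monom (coeff f d) d = [:b:] * g" by (auto simp: dvd_def)
  then have f_split: "f = p + monom (coeff f d) d + [:b:] * g" by (simp add: algebra_simps)
  have in_f: "in_X1 f = in_X1 p + scal (coeff f d) * X1 ^ d + scal b * in_X1 g"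
    by (subst f_split) (simp only: in_X1_simps in_X1_monom)

  have "1 \<in> ideal_gen A {scal b, scal (coeff f d)}"
    unfolding assms(13) by (simp add: assms(5) Ker_def)
  then obtain r s where rs: "r * b + s * coeff f d = 1" using comaximal_scalars by blast
  have Bezout: "scal r * scal b + scal s * scal (coeff f d) = 1"
    using rs by (metis scal_simps(1-3))

  define F where "F = scal b * X2 + in_X1 f"
  have D_F: "D F = 0"
    by (simp add: F_def D_add D_mult D_scal assms(10) assms(6) chain_rule_in_X1[OF der D_scal])

  \<comment> \<open>In the equation \<open>f\<^sub>d X\<^sub>1\<^sup>d = F - p - b W\<close> for \<open>W = X\<^sub>2 + g\<close>, multiplication by \<open>s\<close> turns
    \<open>f\<^sub>d\<close> into \<open>1 - r b\<close>; the term \<open>r X\<^sub>1\<^sup>d\<close> in \<open>z\<close> absorbs the error \<open>r b\<close>.\<close>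
  define z where "z = scal r * X1 ^ d - scal s * (X2 + in_X1 g)"
  define q where "q i = (if i = 0 then scal s * F else 0) - scal (s * coeff f i)" for i
  have "(\<Sum>i<d. q i * X1 ^ i) = (\<Sum>i<d. if i = 0 then scal s * F else 0)
      - scal s * (\<Sum>i<d. scal (coeff f i) * X1 ^ i)"
    unfolding sum_distrib_left sum_subtractf[symmetric]
    by (rule sum.cong) (auto simp: q_def scal_simps algebra_simps)
  also have "(\<Sum>i<d. scal (coeff f i) * X1 ^ i) = in_X1 p"
    by (simp add: p_def in_X1_sum in_X1_monom)
  also have "(\<Sum>i<d. if i = 0 then scal s * F else 0) = scal s * F"
    using d_pos by simp
  finally have q_sum: "(\<Sum>i<d. q i * X1 ^ i) = scal s * F - scal s * in_X1 p" .
  have rel: "X1 ^ d = scal b * z + (\<Sum>i<d. q i * X1 ^ i)"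
  proof -
    have "scal b * z + (\<Sum>i<d. q i * X1 ^ i)
        = (scal r * scal b + scal s * scal (coeff f d)) * X1 ^ d"
      unfolding q_sum z_def F_def in_f by (simp add: algebra_simps)
    then show ?thesis by (simp add: Bezout)
  qed
  have in_low: "in_X1 ([:- r:] * p - g) = - (scal r * in_X1 p) - in_X1 g"
    by (simp only: in_X1_simps scal_simps mult_minus_left)
  \<comment> \<open>Solve \<open>f\<^sub>d z = r f\<^sub>d X\<^sub>1\<^sup>d - (1 - r b) W\<close> for \<open>W = X\<^sub>2 + g(X\<^sub>1)\<close> and substitute \<open>b W\<close>.\<close>
  have X2_eq: "X2 = scal (- coeff f d) * z + scal r * F + in_X1 ([:- r:] * p - g)"
  proof -
    have "scal (- coeff f d) * z + scal r * F + in_X1 ([:- r:] * p - g)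
        = (scal r * scal b + scal s * scal (coeff f d)) * (X2 + in_X1 g) - in_X1 g"
      unfolding in_low z_def F_def in_f by (simp add: scal_simps algebra_simps)
    then show ?thesis by (simp add: Bezout)
  qed

  interpret two_generator_derivation D scal X1 z "scal b" d q
  proof unfold_locales
    show "D (scal c) = 0" for c by (rule D_scal)
    show "D (scal b) = 0" by (rule D_scal)
    show "scal b \<noteq> 0" using assms(7) by (auto simp: scal_def)
    show "D (q i) = 0" for i
      using D_F D_add[of "q i" "scal (s * coeff f i)"] by (auto simp: q_def D_mult D_scal)
    show "subalgebra_gen scal ({X1, z} \<union> Ker D) = UNIV"
    proof -
      have "X2 \<in> subalgebra_gen scal ({X1, z} \<union> Ker D)"
        by (subst X2_eq, intro subalgebra_gen.sum subalgebra_gen.product subalgebra_gen.scalar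
            in_X1_in_subalgebra) (auto intro: subalgebra_gen.generator simp: Ker_def D_F)
      then show ?thesis using subalgebra_gen_X1_X2[of "{X1, z} \<union> Ker D"] by auto
    qed
    show "of_nat n dvd (1 :: 'r poly poly)" if "n > 0" for n
    proof -
      have "of_nat n dvd (1::'r)"
        using of_nat_dvd_one assms(1) that unfolding finitely_generated_algebra_def by blast
      then show ?thesis by (metis scal_dvd_1 scal_of_nat)
    qed
  qed (use assms(6) d_pos rel in auto)
  show ?thesis
    unfolding Min_exponents[OF d_pos] assms(5) by (intro allI impI image_ideal_eq)
qed

end
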